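(* For every complex $q$ with $|q|<1$, $$\sum_{n,l,k=0}^\infty\frac{q^{n^2+l^2+k^2+n+l+k}\,(q^2;q)_{n+l+k}}{(q^2;q)_{n+l}(q^2;q)_{n+k}(q^2;q)_{l+k}(q;q)_n(q;q)_l(q;q)_k}=\frac{1}{(q^2;q)_\infty^2}\prod_{\substack{m\ge1\\ m\not\equiv0,\pm1\ (\mathrm{mod}\ 9)}}\frac{1}{1-q^m}.$$
   Context: Notation: $(x;q)_n=\prod_{j=0}^{n-1}(1-xq^j)$ for integers $n\ge0$, and $(x;q)_\infty=\prod_{j\ge0}(1-xq^j)$. *)

theory Defs
  imports "HOL-Analysis.Analysis"
begin

definition qpoch :: "complex \<Rightarrow> complex \<Rightarrow> nat \<Rightarrow> complex"
  where "qpoch x q n = (\<Prod>j<n. 1 - x * q ^ j)"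

definition qpoch_inf :: "complex \<Rightarrow> complex \<Rightarrow> complex"
  where "qpoch_inf x q = (\<Prod>j. 1 - x * q ^ j)"

text \<open>
  The infinite product operator is only meaningful for convergent products; the two
  products that are used below converge throughout the unit disc.
\<close>

lemma qpoch_inf_convergent:
  fixes x q :: complex
  assumes "norm q < 1"
  shows "convergent_prod (\<lambda>j. 1 - x * q ^ j)"
proof -
  have "summable (\<lambda>j. norm x * norm q ^ j)"
    using assms by (intro summable_mult summable_geometric) simp
  hence "summable (\<lambda>j. norm ((1 - x * q ^ j) - 1))"
    by (simp add: norm_mult norm_power)
  hence "abs_convergent_prod (\<lambda>j. 1 - x * q ^ j)"
    by (rule summable_imp_abs_convergent_prod)
  thus ?thesis
    by (rule abs_convergent_prod_imp_convergent_prod)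
qed

lemma restricted_product_convergent:
  fixes q :: complex
  assumes "norm q < 1"
  shows "convergent_prod (\<lambda>m. if m \<ge> 1 \<and> P m then 1 / (1 - q ^ m) else 1)"
proof -
  let ?f = "\<lambda>m. if m \<ge> 1 \<and> P m then 1 - q ^ m else 1"
  have "summable (\<lambda>m. norm q ^ m)"
    using assms by (intro summable_geometric) simp
  hence "summable (\<lambda>m. norm (?f m - 1))"
    by (rule summable_comparison_test[rotated]) (auto simp: norm_power)
  hence "abs_convergent_prod ?f"
    by (rule summable_imp_abs_convergent_prod)
  hence "convergent_prod ?f"
    by (rule abs_convergent_prod_imp_convergent_prod)
  hence "convergent_prod (\<lambda>m. inverse (?f m))"
    by (rule convergent_prod_inverse)
  moreover have "(\<lambda>m. inverse (?f m)) = (\<lambda>m. if m \<ge> 1 \<and> P m then 1 / (1 - q ^ m) else 1)"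
    by (auto simp: field_simps)
  ultimately show ?thesis by (simp only:)
qed

end

theory Submission
  imports Defs
begin

text \<open>
  Up to powers of \<open>1 - q\<close>, the summand is
  \<open>(q)\<^bsub>n+l+k+1\<^esub> / ((q)\<^bsub>n+l+1\<^esub> (q)\<^bsub>n+k+1\<^esub> (q)\<^bsub>l+k+1\<^esub> (q)\<^sub>n (q)\<^sub>l (q)\<^sub>k)\<close> times a power of \<open>q\<close>.
  A \<open>q\<close>-analogue of Dixon's sum expands this quotient as a single sum over \<open>r\<close> in which
  \<open>n\<close>, \<open>l\<close>, \<open>k\<close> separate: the three factors are \<open>1 / ((q)\<^bsub>n-r\<^esub> (q)\<^bsub>n+r+1\<^esub>)\<close> and its analogues for
  \<open>l\<close> and \<open>k\<close>. Each of the three inner sums is then the Durfee rectangle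
  identity and equals \<open>q\<^bsup>r\<^sup>2+r\<^esup> / (q)\<^sub>\<infinity>\<close>. What is left is \<open>1 / (q)\<^sub>\<infinity>\<^sup>3\<close> times the bilateral theta
  series of nome \<open>q\<^sup>9\<close> folded along \<open>r \<mapsto> -1 - r\<close>, to which the Jacobi triple product applies.
\<close>

section \<open>Finite q-shifted factorials and their reciprocals\<close>

lemma qpoch_Suc: "qpoch x q (Suc n) = qpoch x q n * (1 - x * q ^ n)"
  by (simp add: qpoch_def)

lemma qpoch_qq_Suc: "qpoch q q (Suc n) = qpoch q q n * (1 - q ^ Suc n)"
  by (simp add: qpoch_def)

lemma qpoch_0 [simp]: "qpoch x q 0 = 1"
  by (simp add: qpoch_def)

lemma one_minus_power_nonzero:
  fixes q :: complex
  assumes "norm q < 1"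
  shows "1 - q ^ Suc n \<noteq> 0"
proof
  assume "1 - q ^ Suc n = 0"
  hence "norm (q ^ Suc n) = 1" by simp
  moreover have "norm q ^ Suc n < 1"
    using power_strict_mono[of "norm q" 1 "Suc n"] assms by simp
  ultimately show False by (simp add: norm_power norm_mult)
qed

lemma qpoch_nonzero:
  assumes "norm q < 1"
  shows "qpoch q q n \<noteq> 0"
  using one_minus_power_nonzero[OF assms] by (induction n) (auto simp: qpoch_qq_Suc)

definition qinv :: "complex \<Rightarrow> nat \<Rightarrow> complex"
  where "qinv q n = 1 / qpoch q q n"

text \<open>The convention \<open>1 / (q)\<^sub>i = 0\<close> for \<open>i < 0\<close>, which truncated subtraction would spoil.\<close>

definition qinv_diff :: "complex \<Rightarrow> nat \<Rightarrow> nat \<Rightarrow> complex"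
  where "qinv_diff q n r = (if r \<le> n then qinv q (n - r) else 0)"

lemma qinv_Suc: "norm q < 1 \<Longrightarrow> qinv q n = (1 - q ^ Suc n) * qinv q (Suc n)"
  using one_minus_power_nonzero[of q n] by (simp add: qinv_def qpoch_qq_Suc del: power_Suc)

lemma qinv_0 [simp]: "qinv q 0 = 1"
  by (simp add: qinv_def)

lemma qinv_diff_shift: "qinv_diff q (Suc n) (Suc r) = qinv_diff q n r"
  by (simp add: qinv_diff_def)

text \<open>At r = n + 1 the left side is 0 by convention, and on the right the factor 1 - q^0
  vanishes; the step rule therefore holds for all r, across the boundary of the support.\<close>

lemma qinv_diff_Suc_left: 
  assumes "norm q < 1"
  shows "qinv_diff q n r = (1 - q ^ (Suc n - r)) * qinv_diff q (Suc n) r"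
  using qinv_Suc[OF assms, of "n - r"]
  by (cases "r \<le> n") (auto simp: qinv_diff_def Suc_diff_le le_Suc_eq)

lemma qinv_diff_Suc_right:
  assumes "norm q < 1"
  shows "qinv_diff q n (Suc r) = (1 - q ^ (n - r)) * qinv_diff q n r"
  using qinv_diff_Suc_left[OF assms, of n "Suc r"] qinv_diff_shift by simp

section \<open>The terminating q-Dixon sum\<close>

text \<open>The generalized pentagonal numbers r(3r+1)/2; one of r and 3r+1 is even, so the
  truncating division is exact.\<close>

definition dixon_exp :: "nat \<Rightarrow> nat" where "dixon_exp r = (3 * r\<^sup>2 + r) div 2"

lemma dixon_exp_0 [simp]: "dixon_exp 0 = 0" by (simp add: dixon_exp_def)

lemma dixon_exp_Suc: "dixon_exp (Suc r) = dixon_exp r + 3 * r + 2"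
proof -
  have "3 * (Suc r)\<^sup>2 + Suc r = (3 * r\<^sup>2 + r) + 2 * (3 * r + 2)"
    by (simp add: power2_eq_square)
  thus ?thesis unfolding dixon_exp_def by simp
qed

lemma dixon_exp_ge: "r \<le> dixon_exp r"
  by (induction r) (simp_all add: dixon_exp_Suc)

text \<open>
  The weight \<open>(-1)\<^sup>r q\<^bsup>r(3r+1)/2\<^esup>\<close> of the bilateral sum, with the terms \<open>r\<close> and \<open>-1 - r\<close> combined;
  \<open>bailey_kernel\<close> below is invariant under this reflection.
\<close>

definition dixon_weight :: "complex \<Rightarrow> nat \<Rightarrow> complex"
  where "dixon_weight q r = (-1) ^ r * q ^ dixon_exp r * (1 - q ^ (2 * r + 1))"

text \<open>Up to the factor 1 - q, the kernel that relates the two sequences of a Bailey pair with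
  a = q, because (q^2;q)_{n+r} = (q;q)_{n+r+1} / (1 - q).\<close>

definition bailey_kernel :: "complex \<Rightarrow> nat \<Rightarrow> nat \<Rightarrow> complex"
  where "bailey_kernel q n r = qinv_diff q n r * qinv q (n + r + 1)"

text \<open>
  \<open>G\<close> is a WZ-style certificate for the recurrence in \<open>n\<close>; it vanishes at \<open>r = 0\<close> and for \<open>r > n + 1\<close>.
\<close>

lemma qdixon_step:
  fixes q :: complex and n l k r :: nat
  assumes q: "norm q < 1"
  defines "G \<equiv> \<lambda>r. - (q ^ (Suc n - r)) * (1 - q ^ r) * ((-1) ^ r * q ^ dixon_exp r) *
     (qinv_diff q (Suc n) r * qinv q (n + r + 1)) * (qinv_diff q l r * qinv q (l + r)) *
     (qinv_diff q k r * qinv q (k + r))"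
  shows "(1 - q ^ (n + 1)) * (1 - q ^ (n + l + 2)) * (1 - q ^ (n + k + 2)) *
           (dixon_weight q r * bailey_kernel q (Suc n) r * bailey_kernel q l r * bailey_kernel q k r)
         - (1 - q ^ (n + l + k + 2)) * (dixon_weight q r * bailey_kernel q n r * bailey_kernel q l r * bailey_kernel q k r)
         = G (Suc r) - G r"
proof (cases "r \<le> Suc n \<and> r \<le> l \<and> r \<le> k")
  case False
  then show ?thesis by (auto simp: bailey_kernel_def G_def qinv_diff_def)
next
  case True
  define a where "a = Suc n - r"
  obtain l' where l: "l = r + l'" using True le_Suc_ex by blast
  obtain k' where k: "k = r + k'" using True le_Suc_ex by blast
  define x where "x = q ^ r"
  define A where "A = q ^ a"
  define B where "B = q ^ l'"
  define C where "C = q ^ k'"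
  \<comment> \<open>The reciprocals are raised to the largest index that occurs. Apart from the
    power q^(n-r) treated in \<open>g3\<close>, each term is then a polynomial in x, A, B, C and q
    times \<open>E\<close>, and the claim becomes a polynomial identity.\<close>
  define E where "E = (-1) ^ r * q ^ dixon_exp r * qinv_diff q (Suc n) r * qinv_diff q l r
     * qinv_diff q k r * qinv q (n + r + 2) * qinv q (l + r + 1) * qinv q (k + r + 1)"
  have na: "Suc n = r + a" using True by (simp add: a_def)
  have N: "q ^ Suc n = x * A" by (simp only: na power_add x_def A_def)
  have L: "q ^ l = x * B" by (simp only: l power_add x_def B_def)
  have K: "q ^ k = x * C" by (simp only: k power_add x_def C_def)
  have *: "qinv q (n + r + 1) = (1 - x * x * A * q) * qinv q (n + r + 2)"
    using qinv_Suc[OF q, of "n + r + 1"] N by (simp add: power_add x_def mult_ac)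
  have **: "qinv q (l + r) = (1 - x * x * B * q) * qinv q (l + r + 1)"
    using qinv_Suc[OF q, of "l + r"] L by (simp add: power_add x_def mult_ac)
  have ***: "qinv q (k + r) = (1 - x * x * C * q) * qinv q (k + r + 1)"
    using qinv_Suc[OF q, of "k + r"] K by (simp add: power_add x_def mult_ac)
  have w: "dixon_weight q r = (-1) ^ r * q ^ dixon_exp r * (1 - x * x * q)"
    unfolding dixon_weight_def x_def mult_2 power_add by simp
  have k1: "dixon_weight q r * bailey_kernel q (Suc n) r * bailey_kernel q l r * bailey_kernel q k r = (1 - x * x * q) * E"
    by (simp add: w bailey_kernel_def E_def)
  have k2: "dixon_weight q r * bailey_kernel q n r * bailey_kernel q l r * bailey_kernel q k r
       = (1 - x * x * q) * (1 - A) * (1 - x * x * A * q) * E"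
    using * by (simp add: w bailey_kernel_def E_def qinv_diff_Suc_left[OF q, of n] A_def a_def)
  have g1: "G r = - A * (1 - x) * (1 - x * x * B * q) * (1 - x * x * C * q) * (1 - x * x * A * q) * E"
    using * ** *** by (simp add: G_def E_def A_def a_def x_def)
  have X: "q ^ (n + 1) = x * A" "q ^ (n + l + 2) = x * A * (x * B) * q"
    "q ^ (n + k + 2) = x * A * (x * C) * q" "q ^ (n + l + k + 2) = x * A * (x * B) * (x * C) * q"
    using N unfolding L[symmetric] K[symmetric] by (simp_all add: power_add mult_ac)
  have g2: "G (Suc r) = q ^ (n - r) * (1 - x * q) * (x * x * x * q * q) *
     (1 - A) * (1 - B) * (1 - C) * E"
    unfolding G_def E_def dixon_exp_Suc qinv_diff_Suc_right[OF q] qinv_diff_shift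
      qinv_diff_Suc_left[OF q, of n] A_def a_def B_def C_def l k x_def
    by (simp add: power_add mult_ac power2_eq_square eval_nat_numeral power_mult power_mult_distrib)
  \<comment> \<open>The exponent n - r is truncated only at r = n + 1, where A = 1 and both sides
    vanish; otherwise q^(n-r) * q = A.\<close>
  have g3: "q ^ (n - r) * (1 - A) * q = A * (1 - A)"
  proof (cases a)
    case 0
    thus ?thesis by (simp add: A_def)
  next
    case (Suc b)
    hence "n - r = b" by (simp add: a_def)
    thus ?thesis using Suc by (simp add: A_def)
  qed
  have "(1 - x * A) * (1 - x * A * (x * B) * q) * (1 - x * A * (x * C) * q) * ((1 - x * x * q) * E)
     - (1 - x * A * (x * B) * (x * C) * q) * ((1 - x * x * q) * (1 - A) * (1 - x * x * A * q) * E)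
     = (A * (1 - A)) * (1 - x * q) * (x * x * x * q) * (1 - B) * (1 - C) * E
       - (- A * (1 - x) * (1 - x * x * B * q) * (1 - x * x * C * q) * (1 - x * x * A * q) * E)"
    by (simp add: algebra_simps)
  also have "(A * (1 - A)) * (1 - x * q) * (x * x * x * q) * (1 - B) * (1 - C) * E = G (Suc r)"
    unfolding g2 g3[symmetric] by (simp add: mult_ac)
  finally show ?thesis
    unfolding k1 k2 g1 X by simp
qed

text \<open>Induction on n with l and k fixed: summing \<open>qdixon_step\<close> over r telescopes
  to 0, so both sides obey the same first-order recurrence in n. The range r \<le> N is kept
  independent of n so that the sums for n and n + 1 can be combined; the terms with r > n are
  0.\<close>

lemma qdixon:
  fixes q :: complex
  assumes q: "norm q < 1" and N: "n \<le> N"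
  shows "(\<Sum>r\<le>N. dixon_weight q r * bailey_kernel q n r * bailey_kernel q l r * bailey_kernel q k r) =
    qpoch q q (n + l + k + 1) * (qinv q (n + l + 1) * qinv q (n + k + 1) * qinv q (l + k + 1) *
      qinv q n * qinv q l * qinv q k)"
  using N
proof (induction n)
  case 0
  have "(\<Sum>r\<le>N. dixon_weight q r * bailey_kernel q 0 r * bailey_kernel q l r * bailey_kernel q k r) =
     (\<Sum>r\<in>{0}. dixon_weight q r * bailey_kernel q 0 r * bailey_kernel q l r * bailey_kernel q k r)"
    by (rule sum.mono_neutral_right) (auto simp: bailey_kernel_def qinv_diff_def)
  also have "\<dots> = (1 - q) * qinv q 1 * (qinv q l * qinv q (l + 1)) * (qinv q k * qinv q (k + 1))"
    by (simp add: dixon_weight_def bailey_kernel_def qinv_diff_def)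
  also have "(1 - q) * qinv q 1 = 1"
    using qinv_Suc[OF q, of 0] by simp
  finally show ?case
    using qpoch_nonzero[OF q] by (simp add: qinv_def)
next
  case (Suc n)
  let ?u = "\<lambda>n r. dixon_weight q r * bailey_kernel q n r * bailey_kernel q l r * bailey_kernel q k r"
  let ?R = "\<lambda>n. qpoch q q (n + l + k + 1) * (qinv q (n + l + 1) * qinv q (n + k + 1) *
      qinv q (l + k + 1) * qinv q n * qinv q l * qinv q k)"
  define G where "G = (\<lambda>r. - (q ^ (Suc n - r)) * (1 - q ^ r) * ((-1) ^ r * q ^ dixon_exp r) *
     (qinv_diff q (Suc n) r * qinv q (n + r + 1)) * (qinv_diff q l r * qinv q (l + r)) *
     (qinv_diff q k r * qinv q (k + r)))"
  let ?c = "(1 - q ^ (n + 1)) * (1 - q ^ (n + l + 2)) * (1 - q ^ (n + k + 2))"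
  let ?d = "1 - q ^ (n + l + k + 2)"
  have "?c * (\<Sum>r\<le>N. ?u (Suc n) r) - ?d * (\<Sum>r\<le>N. ?u n r) = (\<Sum>r\<le>N. G (Suc r) - G r)"
    unfolding sum_distrib_left sum_subtractf[symmetric] G_def
    by (intro sum.cong refl qdixon_step q)
  also have "\<dots> = G (Suc N) - G 0"
    by (simp only: lessThan_Suc_atMost[symmetric] sum_lessThan_telescope)
  also have "\<dots> = 0"
    using Suc.prems by (simp add: G_def qinv_diff_def)
  also have "(\<Sum>r\<le>N. ?u n r) = ?R n"
    using Suc by simp
  also have "?d * ?R n = ?c * ?R (Suc n)"
    unfolding qinv_Suc[OF q, of n] qinv_Suc[OF q, of "n + l + 1"] qinv_Suc[OF q, of "n + k + 1"]
    by (simp add: qpoch_qq_Suc mult_ac)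
  finally have eq: "?c * (\<Sum>r\<le>N. ?u (Suc n) r) = ?c * ?R (Suc n)"
    by (simp only: right_minus_eq)
  have "?c \<noteq> 0"
    using one_minus_power_nonzero[OF q, of n] one_minus_power_nonzero[OF q, of "n + l + 1"]
      one_minus_power_nonzero[OF q, of "n + k + 1"] by simp
  from iffD1[OF mult_left_cancel[OF this] eq] show ?case .
qed

section \<open>Limits and the Durfee rectangle identity\<close>

lemma qpoch_inf_nonzero:
  assumes "norm q < 1"
  shows "qpoch_inf q q \<noteq> 0"
  unfolding qpoch_inf_def
  using one_minus_power_nonzero[OF assms] by (intro prodinf_nonzero qpoch_inf_convergent assms) simp

lemma qpoch_tendsto:
  assumes "norm q < 1"
  shows "qpoch x q \<longlonglongrightarrow> qpoch_inf x q"
  using has_prod_imp_tendsto'[OF convergent_prod_has_prod[OF qpoch_inf_convergent[OF assms]]]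
  unfolding qpoch_def qpoch_inf_def .

lemma qinv_tendsto:
  assumes "norm q < 1"
  shows "qinv q \<longlonglongrightarrow> 1 / qpoch_inf q q"
  unfolding qinv_def by (intro tendsto_divide tendsto_const qpoch_tendsto qpoch_inf_nonzero assms)

lemma qinv_bounded:
  assumes "norm q < 1"
  obtains C where "C > 0" "\<And>n. norm (qinv q n) \<le> C"
  using convergent_imp_Bseq[OF convergentI[OF qinv_tendsto[OF assms]]] by (auto simp: Bseq_def)

text \<open>A majorant in s that is uniform in m, as Tannery's theorem requires.\<close>

lemma norm_shifted_square_le:
  fixes q :: complex
  assumes q: "norm q < 1" and C: "C > 0" "\<And>n. norm (qinv q n) \<le> C"
  shows "norm (q ^ (s\<^sup>2 + m * s) * (qinv q s * qinv q (s + m))) \<le> norm q ^ s * (C * C)"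
proof -
  have "norm q ^ (s\<^sup>2 + m * s) \<le> norm q ^ s"
    using q by (intro power_decreasing) (auto simp: power2_eq_square intro: trans_le_add1)
  thus ?thesis
    unfolding norm_mult norm_power using C by (intro mult_mono) (auto intro: less_imp_le)
qed

text \<open>The Durfee rectangle identity. As m tends to infinity only the term s = 0 survives,
  which gives the limit of the sums; it then remains to show that the sums do not depend on
  m.\<close>

lemma sums_shifted_squares:
  fixes q :: complex
  assumes q: "norm q < 1"
  shows "(\<lambda>s. q ^ (s\<^sup>2 + m * s) * (qinv q s * qinv q (s + m))) sums (1 / qpoch_inf q q)"
proof -
  define f where "f = (\<lambda>m s. q ^ (s\<^sup>2 + m * s) * (qinv q s * qinv q (s + m)))"
  define F where "F = (\<lambda>m. suminf (f m))"
  obtain C where C: "C > 0" "\<And>n. norm (qinv q n) \<le> C"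
    using qinv_bounded[OF q] by blast
  have bound_summable: "summable (\<lambda>s. norm q ^ s * (C * C))"
    using q by (intro summable_mult2 summable_geometric) simp
  have sm: "summable (f m)" for m
  proof (rule summable_comparison_test'[OF bound_summable])
    show "norm (f m s) \<le> norm q ^ s * (C * C)" for s
      unfolding f_def by (rule norm_shifted_square_le[OF q C])
  qed
  have Flim: "F \<longlonglongrightarrow> 1 / qpoch_inf q q"
  proof -
    define b where "b = (\<lambda>s::nat. if s = 0 then 1 / qpoch_inf q q else 0)"
    have "(\<lambda>m. f m s) \<longlonglongrightarrow> b s" for s
    proof (cases s)
      case 0
      thus ?thesis using qinv_tendsto[OF q] by (simp add: f_def b_def)
    next
      case (Suc t)
      have "(\<lambda>m. q ^ (s\<^sup>2 + m * s)) \<longlonglongrightarrow> 0"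
      proof (rule Lim_null_comparison)
        show "\<forall>\<^sub>F m in sequentially. norm (q ^ (s\<^sup>2 + m * s)) \<le> norm q ^ m"
          unfolding norm_power using q Suc
          by (intro always_eventually allI power_decreasing) auto
        show "(\<lambda>m. norm q ^ m) \<longlonglongrightarrow> 0"
          using q by (intro LIMSEQ_realpow_zero) auto
      qed
      moreover have "(\<lambda>m. qinv q s * qinv q (m + s)) \<longlonglongrightarrow> qinv q s * (1 / qpoch_inf q q)"
        by (intro tendsto_mult tendsto_const LIMSEQ_ignore_initial_segment qinv_tendsto q)
      ultimately have "(\<lambda>m. q ^ (s\<^sup>2 + m * s) * (qinv q s * qinv q (m + s))) \<longlonglongrightarrow> 0 * (qinv q s * (1 / qpoch_inf q q))"
        by (rule tendsto_mult)
      thus ?thesis using Suc by (simp add: f_def b_def add.commute)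
    qed
    moreover have "norm (f m s) \<le> norm q ^ s * (C * C)" for m s
      unfolding f_def by (rule norm_shifted_square_le[OF q C])
    ultimately have "F \<longlonglongrightarrow> suminf b"
      unfolding F_def using bound_summable
         tannerys_theorem[of "\<lambda>s m. f m s" b sequentially "\<lambda>s. norm q ^ s * (C * C)"]
      by (simp add: case_prod_unfold)
    moreover have "suminf b = 1 / qpoch_inf q q"
      using sums_If_finite_set[of "{0}" "\<lambda>_. 1 / qpoch_inf q q"] by (simp add: b_def sums_iff)
    ultimately show ?thesis by simp
  qed
  have F: "f m sums F m" for m
    unfolding F_def by (rule summable_sums[OF sm])
  \<comment> \<open>The sum is independent of \<open>m\<close>, so it equals its limit: by \<open>d_rec\<close> the \<open>norm (d m)\<close> increase to \<open>0\<close>.\<close>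
  define d where "d = (\<lambda>m. F m - F (Suc m))"
  have d_rec: "d m = - (q ^ Suc m) * d (Suc m)" for m
  proof -
    \<comment> \<open>With X = q^s and Y = q^(m+1), the splitting 1 - XY - X = (1 - X) - XY
      separates \<open>a\<close> from a multiple of \<open>f (Suc m)\<close>. The factor 1 - q^s in
      \<open>a\<close> removes the last factor of (q;q)_s and makes \<open>a 0 = 0\<close>, so
      shifting s by 1 turns \<open>a\<close> into a multiple of
      \<open>f (Suc (Suc m))\<close>.\<close>
    define a where "a = (\<lambda>s. q ^ (s\<^sup>2 + m * s) * (1 - q ^ s) * qinv q s * qinv q (s + m + 1))"
    have aS: "a (Suc t) = q ^ Suc m * f (Suc (Suc m)) t" for t
    proof -
      have e: "(Suc t)\<^sup>2 + m * Suc t = Suc m + (t\<^sup>2 + Suc (Suc m) * t)"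
        by (simp add: power2_eq_square)
      show ?thesis
        unfolding a_def f_def e power_add[of q "Suc m"] qinv_Suc[OF q, of t]
        by (simp add: mult_ac)
    qed
    have fd: "f m s - f (Suc m) s = a s - q ^ Suc m * f (Suc m) s" for s
    proof -
      have e: "q ^ (s\<^sup>2 + Suc m * s) = q ^ (s\<^sup>2 + m * s) * q ^ s"
        by (simp add: power_add mult_ac)
      have e': "qinv q (s + m) = (1 - q ^ s * q ^ Suc m) * qinv q (s + Suc m)"
        using qinv_Suc[OF q, of "s + m"] by (simp add: power_add)
      define Z X Y I J where "Z = q ^ (s\<^sup>2 + m * s)" and "X = q ^ s" and "Y = q ^ Suc m"
        and "I = qinv q s" and "J = qinv q (s + Suc m)"
      have "Z * (I * ((1 - X * Y) * J)) - Z * X * (I * J) = Z * (1 - X) * I * J - Y * (Z * X * (I * J))"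
        by (simp add: algebra_simps)
      thus ?thesis
        unfolding f_def a_def e e' Z_def X_def Y_def I_def J_def by simp
    qed
    have "(\<lambda>t. a (Suc t)) sums (q ^ Suc m * F (Suc (Suc m)))"
      unfolding aS by (intro sums_mult F)
    hence "a sums (q ^ Suc m * F (Suc (Suc m)))"
      by (subst (asm) sums_Suc_iff) (simp add: a_def)
    hence "(\<lambda>s. f m s - f (Suc m) s) sums (q ^ Suc m * F (Suc (Suc m)) - q ^ Suc m * F (Suc m))"
      unfolding fd by (intro sums_diff sums_mult F)
    moreover have "(\<lambda>s. f m s - f (Suc m) s) sums d m"
      unfolding d_def by (intro sums_diff F)
    ultimately have "d m = q ^ Suc m * F (Suc (Suc m)) - q ^ Suc m * F (Suc m)"
      by (rule sums_unique2[rotated])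
    thus ?thesis by (simp add: d_def right_diff_distrib)
  qed
  have "norm (d m) \<le> norm (d (Suc m))" for m
  proof -
    have "norm q ^ Suc m * norm (d (Suc m)) \<le> 1 * norm (d (Suc m))"
      using q by (intro mult_right_mono power_le_one) auto
    thus ?thesis by (subst d_rec) (simp only: norm_mult norm_minus_cancel norm_power mult_1)
  qed
  hence "incseq (\<lambda>m. norm (d m))"
    by (rule incseq_SucI)
  moreover have "d \<longlonglongrightarrow> 0"
    unfolding d_def using tendsto_diff[OF Flim LIMSEQ_Suc[OF Flim]] by simp
  hence "(\<lambda>m. norm (d m)) \<longlonglongrightarrow> 0"
    by (rule tendsto_norm_zero)
  ultimately have "norm (d m) \<le> 0" for m
    by (rule incseq_le)
  hence "F (Suc m) = F m" for m
    by (simp add: d_def)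
  hence "F n = F 0" for n
    by (induction n) simp_all
  hence "F = (\<lambda>_. F 0)" "F m = F 0"
    by blast+
  hence "F m = 1 / qpoch_inf q q"
    using Flim LIMSEQ_unique[OF tendsto_const, of "F 0" "1 / qpoch_inf q q"] by simp
  thus ?thesis using F[of m] by (simp add: f_def)
qed

section \<open>The Jacobi triple product\<close>

text \<open>The general term of Ramanujan's two-variable theta series at -z and -w. Continued to
  negative indices, the term at -1 - r is -z^(2r+1) times the term at r; this is the source of the
  factor 1 - z^(2r+1) below.\<close>

definition theta_coeff :: "complex \<Rightarrow> complex \<Rightarrow> nat \<Rightarrow> complex"
  where "theta_coeff z w r = (-1) ^ r * z ^ (r choose 2) * w ^ (Suc r choose 2)"

lemma theta_coeff_0 [simp]: "theta_coeff z w 0 = 1"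
  by (simp add: theta_coeff_def numeral_2_eq_2)

lemma theta_coeff_Suc: "theta_coeff z w (Suc r) = - w * (z * w) ^ r * theta_coeff z w r"
  by (simp add: theta_coeff_def numeral_2_eq_2 power_add power_mult_distrib)

text \<open>
  \<open>K\<close> comes from applying the \<open>q\<close>-Pascal rule twice to \<open>1 / ((Q)\<^bsub>m+1-r\<^esub> (Q)\<^bsub>m+r+2\<^esub>)\<close> and summing by
  parts, with \<open>r\<close> and \<open>-1 - r\<close> combined.
\<close>

lemma theta_step:
  fixes z w :: complex and m r :: nat
  defines "Q \<equiv> z * w"
  assumes Q: "norm Q < 1"
  defines "K \<equiv> \<lambda>r. theta_coeff z w r *
     (- (Q ^ (Suc m - r)) * (1 - z ^ (2 * r + 1)) * (qinv_diff Q (Suc m) r * qinv Q (m + r))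
      + Q ^ Suc m * (z ^ (2 * r) - z) * (qinv_diff Q m r * qinv Q (m + r + 1)))"
  shows "theta_coeff z w r * (1 - z ^ (2 * r + 1)) *
      ((1 - Q ^ (2 * m + 2)) * (1 - Q ^ (2 * m + 3)) * bailey_kernel Q (Suc m) r
        - (1 - z * Q ^ Suc m) * (1 - w * Q ^ m) * bailey_kernel Q m r) = K (Suc r) - K r"
proof (cases "r \<le> Suc m")
  case False
  then show ?thesis by (simp add: bailey_kernel_def K_def qinv_diff_def)
next
  case True
  define a where "a = Suc m - r"
  define x where "x = Q ^ r"
  define A where "A = Q ^ a"
  define Z where "Z = z ^ r"
  have ma: "Suc m = r + a" using True by (simp add: a_def)
  have M: "Q ^ Suc m = x * A" by (simp only: ma power_add x_def A_def)
  define E where "E = theta_coeff z w r * qinv_diff Q (Suc m) r * qinv Q (m + r + 2)"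
  have i1: "qinv Q (m + r + 1) = (1 - x * x * A * Q) * qinv Q (m + r + 2)"
    using qinv_Suc[OF Q, of "m + r + 1"] M by (simp add: power_add x_def mult_ac)
  have i0: "qinv Q (m + r) = (1 - x * x * A) * ((1 - x * x * A * Q) * qinv Q (m + r + 2))"
  proof -
    have "Q ^ Suc (m + r) = x * x * A"
      using M unfolding add_Suc[symmetric] power_add x_def[symmetric] by (simp only: mult_ac)
    thus ?thesis
      using qinv_Suc[OF Q, of "m + r"] i1 by simp
  qed
  have d: "qinv_diff Q m r = (1 - A) * qinv_diff Q (Suc m) r"
    using qinv_diff_Suc_left[OF Q, of m r] by (simp add: A_def a_def)
  have P: "Q ^ (2 * m + 2) = x * A * (x * A)" "Q ^ (2 * m + 3) = x * A * (x * A) * Q"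
  proof -
    have "2 * m + 2 = Suc m + Suc m" "2 * m + 3 = Suc m + Suc m + 1"
      by simp_all
    thus "Q ^ (2 * m + 2) = x * A * (x * A)" "Q ^ (2 * m + 3) = x * A * (x * A) * Q"
      by (simp_all only: power_add M power_one_right)
  qed
  have k1: "bailey_kernel Q (Suc m) r = qinv_diff Q (Suc m) r * qinv Q (m + r + 2)"
    by (simp add: bailey_kernel_def)
  have k2: "bailey_kernel Q m r = (1 - A) * (1 - x * x * A * Q) * (qinv_diff Q (Suc m) r * qinv Q (m + r + 2))"
    unfolding bailey_kernel_def i1 d by simp
  have ZZ: "z ^ (2 * r + 1) = Z * Z * z" "z ^ (2 * r) = Z * Z" "z ^ (2 * Suc r + 1) = Z * Z * z * z * z"
    "z ^ (2 * Suc r) = Z * Z * z * z"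
    by (simp_all add: Z_def mult_2 power_add)
  have g1: "K r = (- A * (1 - Z * Z * z) * (1 - x * x * A) * (1 - x * x * A * Q)
      + x * A * (Z * Z - z) * (1 - A) * (1 - x * x * A * Q)) * E"
    unfolding K_def E_def M i0 i1 d ZZ by (simp add: A_def a_def algebra_simps)
  have i2: "qinv_diff Q m (Suc r) = (1 - Q ^ (m - r)) * (1 - A) * qinv_diff Q (Suc m) r"
    unfolding qinv_diff_Suc_right[OF Q] d by simp
  define B where "B = Q ^ (m - r)"
  have B: "B * (1 - A) * Q = A * (1 - A)"
  proof (cases a)
    case 0
    thus ?thesis by (simp add: A_def)
  next
    case (Suc b)
    hence "m - r = b" by (simp add: a_def)
    thus ?thesis using Suc by (simp add: A_def B_def)
  qed
  have g2: "K (Suc r) = - w * x *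
     (- B * (1 - Z * Z * z * z * z) * (1 - x * x * A * Q) 
      + x * A * (Z * Z * z * z - z) * (1 - B)) * (1 - A) * E"
  proof -
    have "qinv_diff Q (Suc m) (Suc r) * qinv Q (m + Suc r) =
        (1 - A) * qinv_diff Q (Suc m) r * ((1 - x * x * A * Q) * qinv Q (m + r + 2))"
      using i1 d by (simp add: qinv_diff_shift)
    moreover have "qinv_diff Q m (Suc r) * qinv Q (m + Suc r + 1) =
        (1 - B) * (1 - A) * qinv_diff Q (Suc m) r * qinv Q (m + r + 2)"
      using i2 by (simp add: B_def)
    ultimately show ?thesis
      unfolding K_def theta_coeff_Suc M ZZ E_def diff_Suc_Suc B_def[symmetric] Q_def[symmetric] x_def[symmetric]
      by (simp only:) (simp add: algebra_simps)
  qed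
  \<comment> \<open>Q^m = x * B can fail only at r = m + 1, through the truncated m - r; there 1 - A
    = 0.\<close>
  have wm: "w * Q ^ m * (1 - A) = w * x * B * (1 - A)"
  proof (cases a)
    case 0
    thus ?thesis by (simp add: A_def)
  next
    case (Suc b)
    hence "m = r + (m - r)" by (simp add: a_def)
    hence "Q ^ m = x * B" unfolding x_def B_def by (metis power_add)
    thus ?thesis by simp
  qed
  \<comment> \<open>\<open>V\<close> stands for T / z: since Q = z * w, one has z * V = T without
    dividing by z, which may be 0. After this and \<open>QB\<close>, B enters only through
    \<open>V\<close>.\<close>
  define V T Y where "V = w * B * (1 - A)" and "T = A * (1 - A)" and "Y = 1 - x * x * A * Q"
  have zV: "z * V = T"
    using B by (simp add: V_def T_def Q_def mult_ac)
  have QB: "Q * (1 - B) * (1 - A) = Q * (1 - A) - T"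
    using B by (simp add: T_def algebra_simps)
  have g3: "K (Suc r) = x * (V - Z * Z * z * z * T) * Y * E - x * x * A * (Z * Z * z - 1) * (Q * (1 - A) - T) * E"
  proof -
    have "K (Suc r) = x * (V - Z * Z * z * z * (z * V)) * Y * E
        - x * x * A * (Z * Z * z - 1) * ((z * w) * (1 - B) * (1 - A)) * E"
      unfolding g2 V_def Y_def by (simp add: algebra_simps)
    thus ?thesis unfolding zV Q_def[symmetric] QB .
  qed
  have "(1 - Z * Z * z) *
      ((1 - x * A * (x * A)) * (1 - x * A * (x * A) * Q) * E
        - (1 - z * (x * A)) * ((1 - A) - w * Q ^ m * (1 - A)) * Y * E)
    = (1 - Z * Z * z) * ((1 - x * A * (x * A)) * (1 - x * A * (x * A) * Q) * E
        - ((1 - A) - x * z * T) * Y * E) + (x * V - Z * Z * x * (z * V)) * Y * E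
       - (1 - Z * Z * z) * x * x * A * (z * V) * Y * E"
    unfolding wm by (simp add: V_def T_def algebra_simps)
  also have "\<dots> = K (Suc r) - K r"
    unfolding g3 g1 zV unfolding T_def Y_def by (simp add: algebra_simps)
  finally show ?thesis
    unfolding k1 k2 ZZ P M E_def Y_def by (simp add: algebra_simps)
qed

text \<open>A finite form of the Jacobi triple product with nome \<open>z * w\<close>.\<close>

lemma finite_theta_identity:
  fixes z w :: complex
  assumes Q: "norm (z * w) < 1" and "m \<le> N"
  shows "(\<Sum>r\<le>N. theta_coeff z w r * (1 - z ^ (2 * r + 1)) * bailey_kernel (z * w) m r) =
    qpoch z (z * w) (Suc m) * qpoch w (z * w) m * qinv (z * w) (2 * m + 1)"
  using \<open>m \<le> N\<close>
proof (induction m)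
  case 0
  have "(\<Sum>r\<le>N. theta_coeff z w r * (1 - z ^ (2 * r + 1)) * bailey_kernel (z * w) 0 r) =
     (\<Sum>r\<in>{0}. theta_coeff z w r * (1 - z ^ (2 * r + 1)) * bailey_kernel (z * w) 0 r)"
    by (rule sum.mono_neutral_right) (auto simp: bailey_kernel_def qinv_diff_def)
  thus ?case
    by (simp add: bailey_kernel_def qinv_diff_def qpoch_def)
next
  case (Suc m)
  define Q where "Q = z * w"
  note Q' = Q[folded Q_def]
  let ?t = "\<lambda>r. theta_coeff z w r * (1 - z ^ (2 * r + 1))"
  define K where "K = (\<lambda>r. theta_coeff z w r *
     (- (Q ^ (Suc m - r)) * (1 - z ^ (2 * r + 1)) * (qinv_diff Q (Suc m) r * qinv Q (m + r))
      + Q ^ Suc m * (z ^ (2 * r) - z) * (qinv_diff Q m r * qinv Q (m + r + 1))))"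
  let ?c = "(1 - Q ^ (2 * m + 2)) * (1 - Q ^ (2 * m + 3))"
  let ?d = "(1 - z * Q ^ Suc m) * (1 - w * Q ^ m)"
  let ?S = "\<lambda>m. \<Sum>r\<le>N. ?t r * bailey_kernel Q m r"
  let ?R = "\<lambda>m. qpoch z Q (Suc m) * qpoch w Q m * qinv Q (2 * m + 1)"
  have "?c * ?S (Suc m) - ?d * ?S m = (\<Sum>r\<le>N. ?t r * (?c * bailey_kernel Q (Suc m) r - ?d * bailey_kernel Q m r))"
    unfolding sum_distrib_left sum_subtractf[symmetric] by (intro sum.cong refl) (simp add: algebra_simps)
  also have "\<dots> = (\<Sum>r\<le>N. K (Suc r) - K r)"
    unfolding K_def Q_def by (intro sum.cong refl theta_step Q)
  also have "\<dots> = K (Suc N) - K 0"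
    by (simp only: lessThan_Suc_atMost[symmetric] sum_lessThan_telescope)
  also have "K (Suc N) = 0"
    using Suc.prems by (simp add: K_def qinv_diff_def)
  \<comment> \<open>At r = 0 the two summands of \<open>K\<close> are opposite, both with the factor
    1 - z.\<close>
  also have "K 0 = 0"
    by (simp add: K_def qinv_diff_def algebra_simps)
  finally have "?c * ?S (Suc m) = ?d * ?S m"
    by simp
  also have "?S m = ?R m"
    using Suc unfolding Q_def by simp
  also have "?d * ?R m = ?c * ?R (Suc m)"
  proof -
    have "qinv Q (2 * m + 1) = ?c * qinv Q (2 * Suc m + 1)"
      using qinv_Suc[OF Q', of "2 * m + 1"] qinv_Suc[OF Q', of "2 * m + 2"]
      by (simp add: eval_nat_numeral mult.assoc)
    thus ?thesis
      unfolding qpoch_Suc[of z Q "Suc m"] qpoch_Suc[of w Q m] by (simp only: mult_ac)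
  qed
  finally have eq: "?c * ?S (Suc m) = ?c * ?R (Suc m)" .
  have "?c \<noteq> 0"
    using one_minus_power_nonzero[OF Q', of "2 * m + 1"] one_minus_power_nonzero[OF Q', of "2 * m + 2"]
    by (simp add: eval_nat_numeral)
  from iffD1[OF mult_left_cancel[OF this] eq] show ?case
    unfolding Q_def .
qed

lemma bailey_kernel_bounded:
  assumes "norm q < 1"
  obtains C where "C > 0" "\<And>n r. norm (bailey_kernel q n r) \<le> C"
proof -
  obtain C where C: "C > 0" "\<And>n. norm (qinv q n) \<le> C"
    using qinv_bounded[OF assms] by blast
  have "norm (bailey_kernel q n r) \<le> C * C" for n r
    unfolding bailey_kernel_def qinv_diff_def norm_mult
    using C by (intro mult_mono) (auto intro: less_imp_le)
  thus ?thesis using that[of "C * C"] C by simp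
qed

lemma bailey_kernel_tendsto:
  assumes "norm q < 1"
  shows "(\<lambda>n. bailey_kernel q n r) \<longlonglongrightarrow> (1 / qpoch_inf q q)\<^sup>2"
proof -
  have "(\<lambda>n. bailey_kernel q (n + r) r) \<longlonglongrightarrow> (1 / qpoch_inf q q) * (1 / qpoch_inf q q)"
    unfolding bailey_kernel_def qinv_diff_def
    using tendsto_mult[OF qinv_tendsto[OF assms] LIMSEQ_ignore_initial_segment[OF qinv_tendsto[OF assms], of "r + r + 1"]]
    by (simp add: add_ac)
  thus ?thesis
    unfolding power2_eq_square by (rule LIMSEQ_offset)
qed

text \<open>The limit of \<open>finite_theta_identity\<close> as m tends to infinity, with Q = z *
  w: the kernel tends to 1 / (Q;Q)_inf^2 and the right side to (z;Q)_inf (w;Q)_inf / (Q;Q)_inf.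
  Tannery's theorem justifies the termwise limit.\<close>

lemma theta_sums:
  fixes z w :: complex
  assumes z: "norm z < 1" and w: "norm w < 1"
  shows "(\<lambda>r. theta_coeff z w r * (1 - z ^ (2 * r + 1))) sums
    (qpoch_inf (z * w) (z * w) * qpoch_inf z (z * w) * qpoch_inf w (z * w))"
proof -
  define Q where "Q = z * w"
  have Q: "norm Q < 1"
    using mult_strict_mono[of "norm z" 1 "norm w" 1] z w by (simp add: Q_def norm_mult)
  define t where "t = (\<lambda>r. theta_coeff z w r * (1 - z ^ (2 * r + 1)))"
  define P where "P = qpoch_inf Q Q"
  have P: "P \<noteq> 0"
    unfolding P_def by (rule qpoch_inf_nonzero[OF Q])
  \<comment> \<open>The exponent r(r+1)/2 of w is at least r, and the folded factor has norm at most
    2; this supplies the majorant.\<close>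
  have t: "norm (t r) \<le> 2 * norm w ^ r" for r
  proof -
    have "norm (theta_coeff z w r) \<le> 1 * norm w ^ r"
      unfolding theta_coeff_def norm_mult norm_power using z w
      by (intro mult_mono power_le_one power_decreasing) (auto simp: numeral_2_eq_2 power_le_one)
    moreover have "norm (1 - z ^ (2 * r + 1)) \<le> 2"
    proof -
      have "norm (z ^ (2 * r + 1)) \<le> 1"
        unfolding norm_power using z by (intro power_le_one) auto
      thus ?thesis using norm_triangle_ineq4[of 1 "z ^ (2 * r + 1)"] by simp
    qed
    ultimately have "norm (theta_coeff z w r) * norm (1 - z ^ (2 * r + 1)) \<le> (1 * norm w ^ r) * 2"
      by (intro mult_mono) auto
    thus ?thesis unfolding t_def norm_mult by simp
  qed
  obtain C where C: "C > 0" "\<And>n r. norm (bailey_kernel Q n r) \<le> C"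
    using bailey_kernel_bounded[OF Q] by blast
  have sm: "summable (\<lambda>r. 2 * norm w ^ r)"
    using w by (intro summable_mult summable_geometric) simp
  have st: "summable t"
    by (rule summable_comparison_test'[OF sm t])
  have "norm (t r * bailey_kernel Q m r) \<le> 2 * norm w ^ r * C" for m r
    unfolding norm_mult by (intro mult_mono t C) auto
  moreover have "(\<lambda>m. t r * bailey_kernel Q m r) \<longlonglongrightarrow> t r * (1 / P)\<^sup>2" for r
    unfolding P_def by (intro tendsto_mult tendsto_const bailey_kernel_tendsto Q)
  moreover have "summable (\<lambda>r. 2 * norm w ^ r * C)"
    by (intro summable_mult2 sm)
  ultimately have "(\<lambda>m. \<Sum>r. t r * bailey_kernel Q m r) \<longlonglongrightarrow> (\<Sum>r. t r * (1 / P)\<^sup>2)"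
    using tannerys_theorem[of "\<lambda>r m. t r * bailey_kernel Q m r" "\<lambda>r. t r * (1 / P)\<^sup>2" sequentially
        "\<lambda>r. 2 * norm w ^ r * C"]
    by (simp add: case_prod_unfold)
  moreover have "(\<Sum>r. t r * bailey_kernel Q m r) = qpoch z Q (Suc m) * qpoch w Q m * qinv Q (2 * m + 1)" for m
  proof -
    have "(\<Sum>r. t r * bailey_kernel Q m r) = (\<Sum>r\<le>m. t r * bailey_kernel Q m r)"
      by (rule suminf_finite) (auto simp: bailey_kernel_def qinv_diff_def)
    thus ?thesis
      using finite_theta_identity[OF Q[unfolded Q_def] order_refl] by (simp add: t_def Q_def)
  qed
  moreover have "(\<lambda>m. qpoch z Q (Suc m) * qpoch w Q m * qinv Q (2 * m + 1)) \<longlonglongrightarrow>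
      qpoch_inf z Q * qpoch_inf w Q * (1 / P)"
  proof (intro tendsto_mult qpoch_tendsto Q LIMSEQ_Suc)
    have "strict_mono (\<lambda>m::nat. 2 * m + 1)"
      by (auto simp: strict_mono_def)
    from LIMSEQ_subseq_LIMSEQ[OF qinv_tendsto[OF Q] this]
    show "(\<lambda>m. qinv Q (2 * m + 1)) \<longlonglongrightarrow> 1 / P"
      by (simp add: o_def P_def)
  qed
  ultimately have "(\<Sum>r. t r * (1 / P)\<^sup>2) = qpoch_inf z Q * qpoch_inf w Q * (1 / P)"
    using LIMSEQ_unique by (simp only:) 
  moreover have "(\<Sum>r. t r * (1 / P)\<^sup>2) = suminf t * (1 / P)\<^sup>2"
    by (rule suminf_mult2[OF st, symmetric])
  ultimately have "suminf t = P * qpoch_inf z Q * qpoch_inf w Q"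
    using P by (simp add: power2_eq_square field_simps)
  thus ?thesis
    using summable_sums[OF st] by (simp add: t_def P_def Q_def)
qed

section \<open>Summation of the kernel over n\<close>

text \<open>The kernel vanishes for n < r. With n = s + r the exponent n^2 + n becomes (r^2 + r) +
  s^2 + (2r+1)s, so this is the Durfee rectangle identity with m = 2r + 1. Absolute convergence
  turns the series into an unordered sum.\<close>

lemma bailey_kernel_sum:
  fixes q :: complex
  assumes q: "norm q < 1"
  shows "((\<lambda>n. q ^ (n\<^sup>2 + n) * bailey_kernel q n r) has_sum (q ^ (r\<^sup>2 + r) / qpoch_inf q q)) UNIV"
proof (rule norm_summable_imp_has_sum)
  let ?f = "\<lambda>n. q ^ (n\<^sup>2 + n) * bailey_kernel q n r"
  have "?f (s + r) = q ^ (r\<^sup>2 + r) * (q ^ (s\<^sup>2 + (2 * r + 1) * s) * (qinv q s * qinv q (s + (2 * r + 1))))" for s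
  proof -
    have e: "(s + r)\<^sup>2 + (s + r) = (r\<^sup>2 + r) + (s\<^sup>2 + (2 * r + 1) * s)"
      by (simp add: power2_eq_square algebra_simps)
    have e': "s + r + r + 1 = s + (2 * r + 1)"
      by simp
    show ?thesis
      unfolding e power_add[of q "r\<^sup>2 + r"] bailey_kernel_def e' by (simp add: qinv_diff_def)
  qed
  hence "(\<lambda>s. ?f (s + r)) sums (q ^ (r\<^sup>2 + r) * (1 / qpoch_inf q q))"
    using sums_mult[OF sums_shifted_squares[OF q, of "2 * r + 1"], of "q ^ (r\<^sup>2 + r)"] by simp
  hence "?f sums (q ^ (r\<^sup>2 + r) * (1 / qpoch_inf q q) + (\<Sum>n<r. ?f n))"
    by (rule iffD1[OF sums_iff_shift])
  moreover have "(\<Sum>n<r. ?f n) = 0"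
    by (rule sum.neutral) (auto simp: bailey_kernel_def qinv_diff_def)
  ultimately show "?f sums (q ^ (r\<^sup>2 + r) / qpoch_inf q q)"
    by simp
  obtain C where C: "C > 0" "\<And>n r. norm (bailey_kernel q n r) \<le> C"
    using bailey_kernel_bounded[OF q] by blast
  show "summable (\<lambda>n. norm (?f n))"
  proof (rule summable_comparison_test')
    show "summable (\<lambda>n. norm q ^ n * C)"
      using q by (intro summable_mult2 summable_geometric) simp
    show "norm (norm (?f n)) \<le> norm q ^ n * C" for n
      unfolding real_norm_def abs_norm_cancel unfolding norm_mult norm_power
      using C q by (intro mult_mono power_decreasing) auto
  qed
qed

section \<open>The product modulo 9\<close>

lemma restricted_product_mod_9:
  fixes q :: complex
  assumes q: "norm q < 1"
  shows "(\<Prod>m. if m \<ge> 1 \<and> m mod 9 \<notin> {0, 1, 8} then 1 / (1 - q ^ m) else 1) =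
    qpoch_inf (q ^ 9) (q ^ 9) * qpoch_inf q (q ^ 9) * qpoch_inf (q ^ 8) (q ^ 9) / qpoch_inf q q"
proof -
  define f where "f = (\<lambda>m. if m \<ge> 1 \<and> m mod 9 \<notin> {0, 1, 8} then 1 / (1 - q ^ m) else (1::complex))"
  have q9: "norm (q ^ 9) < 1"
    using q power_strict_mono[of "norm q" 1 9] by (simp add: norm_power)
  \<comment> \<open>the factors for \<open>m = j + 1\<close>, so that a block of nine starts at residue \<open>1\<close>\<close>
  define g where "g = (\<lambda>j. f (Suc j) * (1 - q ^ Suc j))"
  \<comment> \<open>The residues 1, 8 and 0 of m = 9M + i + 1 sit at i = 0, 7 and 8.\<close>
  have g_block: "g (9 * M + i) = (if i \<in> {0, 7, 8} then 1 - q ^ Suc (9 * M + i) else 1)" if "i < 9" for M i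
  proof -
    have "Suc (9 * M + i) mod 9 \<in> {0, 1, 8} \<longleftrightarrow> i \<in> {0, 7, 8}"
      using that by (simp only: insert_iff empty_iff) presburger
    thus ?thesis
      using one_minus_power_nonzero[OF q, of "9 * M + i"] by (auto simp: g_def f_def simp del: power_Suc)
  qed
  have prod_add: "(\<Prod>j<a + n. g j) = (\<Prod>j<a. g j) * (\<Prod>i<n. g (a + i))" for a n
    by (induction n) (simp_all add: mult_ac)
  \<comment> \<open>Since \<open>f 0 = 1\<close>, the first n + 1 values of \<open>f\<close> pair
    with the n factors of (q;q)_n.\<close>
  have "(\<Prod>m<Suc n. f m) * qpoch q q n = (\<Prod>j<n. g j)" for n
    unfolding prod.lessThan_Suc_shift by (simp add: g_def f_def qpoch_def prod.distrib)
  moreover have "(\<Prod>j<9 * M. g j) =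
      qpoch (q ^ 9) (q ^ 9) M * qpoch q (q ^ 9) M * qpoch (q ^ 8) (q ^ 9) M" for M
  proof (induction M)
    case 0
    show ?case by simp
  next
    case (Suc M)
    have "(\<Prod>i<9. g (9 * M + i)) = (\<Prod>i\<in>{0, 7, 8}. 1 - q ^ Suc (9 * M + i))"
    proof -
      have "(\<Prod>i<9. g (9 * M + i)) = (\<Prod>i<9. if i \<in> {0, 7, 8} then 1 - q ^ Suc (9 * M + i) else 1)"
        by (intro prod.cong refl g_block) simp
      also have "\<dots> = (\<Prod>i\<in>{0, 7, 8}. 1 - q ^ Suc (9 * M + i))"
        by (rule prod.mono_neutral_cong_right) auto
      finally show ?thesis .
    qed
    also have "\<dots> = (1 - q ^ 9 * (q ^ 9) ^ M) * (1 - q * (q ^ 9) ^ M) * (1 - q ^ 8 * (q ^ 9) ^ M)"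
    proof -
      have e: "Suc (9 * M + 0) = 1 + 9 * M" "Suc (9 * M + 7) = 8 + 9 * M" "Suc (9 * M + 8) = 9 + 9 * M"
        by simp_all
      have p: "(\<Prod>i\<in>{0, 7, 8}. X i) = X 0 * X 7 * X 8" for X :: "nat \<Rightarrow> complex"
        by (simp add: mult.assoc)
      show ?thesis
        unfolding p e power_add power_mult power_one_right by (simp only: mult_ac)
    qed
    finally have "(\<Prod>j<9 * M + 9. g j) = (qpoch (q ^ 9) (q ^ 9) M * qpoch q (q ^ 9) M * qpoch (q ^ 8) (q ^ 9) M) *
      ((1 - q ^ 9 * (q ^ 9) ^ M) * (1 - q * (q ^ 9) ^ M) * (1 - q ^ 8 * (q ^ 9) ^ M))"
      unfolding prod_add Suc.IH by simp
    also have "\<dots> = qpoch (q ^ 9) (q ^ 9) (Suc M) * qpoch q (q ^ 9) (Suc M) * qpoch (q ^ 8) (q ^ 9) (Suc M)"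
      unfolding qpoch_Suc by (simp only: mult_ac)
    finally show ?case by (simp add: add.commute)
  qed
  ultimately have *: "(\<Prod>m<Suc (9 * M). f m) * qpoch q q (9 * M) = 
      qpoch (q ^ 9) (q ^ 9) M * qpoch q (q ^ 9) M * qpoch (q ^ 8) (q ^ 9) M" for M
    by simp
  have sub: "strict_mono (\<lambda>M::nat. Suc (9 * M))" "strict_mono (\<lambda>M::nat. 9 * M)"
    by (auto simp: strict_mono_def)
  have "convergent_prod f"
    unfolding f_def by (rule restricted_product_convergent[OF q])
  hence "(\<lambda>n. \<Prod>m<n. f m) \<longlonglongrightarrow> prodinf f"
    by (intro has_prod_imp_tendsto' convergent_prod_has_prod)
  from tendsto_mult[OF LIMSEQ_subseq_LIMSEQ[OF this sub(1)] LIMSEQ_subseq_LIMSEQ[OF qpoch_tendsto[OF q] sub(2)], of q]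
  have "(\<lambda>M. (\<Prod>m<Suc (9 * M). f m) * qpoch q q (9 * M)) \<longlonglongrightarrow> prodinf f * qpoch_inf q q"
    by (simp add: o_def)
  moreover have "(\<lambda>M. (\<Prod>m<Suc (9 * M). f m) * qpoch q q (9 * M)) \<longlonglongrightarrow>
     qpoch_inf (q ^ 9) (q ^ 9) * qpoch_inf q (q ^ 9) * qpoch_inf (q ^ 8) (q ^ 9)"
    unfolding * by (intro tendsto_mult qpoch_tendsto q9)
  ultimately have "prodinf f * qpoch_inf q q = 
     qpoch_inf (q ^ 9) (q ^ 9) * qpoch_inf q (q ^ 9) * qpoch_inf (q ^ 8) (q ^ 9)"
    by (rule LIMSEQ_unique)
  thus ?thesis
    using qpoch_inf_nonzero[OF q] unfolding f_def by (simp add: eq_divide_eq)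
qed

section \<open>Unordered sums over products\<close>

lemma abs_summable_on_product:
  fixes f :: "'a \<Rightarrow> 'c::real_normed_field" and g :: "'b \<Rightarrow> 'c"
  assumes f: "(\<lambda>x. norm (f x)) summable_on A" and g: "(\<lambda>y. norm (g y)) summable_on B"
  shows "(\<lambda>p. norm (f (fst p) * g (snd p))) summable_on (A \<times> B)"
proof (rule summable_on_SigmaI)
  show "((\<lambda>y. norm (f (fst (x, y)) * g (snd (x, y)))) has_sum
          norm (f x) * infsum (\<lambda>y. norm (g y)) B) B" for x
    unfolding fst_conv snd_conv norm_mult by (intro has_sum_cmult_right has_sum_infsum g)
  show "(\<lambda>x. norm (f x) * infsum (\<lambda>y. norm (g y)) B) summable_on A"
    by (intro summable_on_cmult_left f)
qed auto

text \<open>Absolute summability provides some sum S over the product set; summing over B first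
  gives \<open>f x * b\<close>, whose sum over A identifies S as \<open>a * b\<close>.\<close>

lemma has_sum_product:
  fixes f :: "'a \<Rightarrow> 'c::{real_normed_field,banach}" and g :: "'b \<Rightarrow> 'c"
  assumes f: "(f has_sum a) A" "(\<lambda>x. norm (f x)) summable_on A"
    and g: "(g has_sum b) B" "(\<lambda>y. norm (g y)) summable_on B"
  shows "((\<lambda>p. f (fst p) * g (snd p)) has_sum (a * b)) (A \<times> B)"
proof -
  have "(\<lambda>p. f (fst p) * g (snd p)) summable_on (A \<times> B)"
    by (rule abs_summable_summable[OF abs_summable_on_product[OF f(2) g(2)]])
  then obtain S where S: "((\<lambda>p. f (fst p) * g (snd p)) has_sum S) (A \<times> B)"
    by (auto simp: summable_on_def)
  have "((\<lambda>x. f x * b) has_sum S) A"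
    by (rule has_sum_SigmaD[OF S]) (auto intro: has_sum_cmult_right g(1))
  moreover have "((\<lambda>x. f x * b) has_sum (a * b)) A"
    by (intro has_sum_cmult_left f(1))
  ultimately have "S = a * b"
    by (rule has_sum_unique)
  thus ?thesis using S by simp
qed

section \<open>Evaluation of the triple sum\<close>

lemma qpoch_square: "(1 - q) * qpoch (q\<^sup>2) q n = qpoch q q (Suc n)"
  unfolding qpoch_def prod.lessThan_Suc_shift by (simp add: power2_eq_square mult.assoc)

lemma qpoch_inf_square:
  assumes "norm q < 1"
  shows "(1 - q) * qpoch_inf (q\<^sup>2) q = qpoch_inf q q"
proof (rule LIMSEQ_unique)
  show "(\<lambda>n. (1 - q) * qpoch (q\<^sup>2) q n) \<longlonglongrightarrow> (1 - q) * qpoch_inf (q\<^sup>2) q"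
    by (intro tendsto_mult tendsto_const qpoch_tendsto assms)
  show "(\<lambda>n. (1 - q) * qpoch (q\<^sup>2) q n) \<longlonglongrightarrow> qpoch_inf q q"
    unfolding qpoch_square by (intro LIMSEQ_Suc qpoch_tendsto assms)
qed

text \<open>Each of the three inner sums contributes q^(r^2+r), hence the cube. The exponents add up
  to (9r^2 + 7r)/2 = r(r-1)/2 + 8 r(r+1)/2, which dictates z = q and w = q^8 and so the modulus
  9.\<close>

lemma dixon_weight_theta_coeff:
  "dixon_weight q r * (q ^ (r\<^sup>2 + r)) ^ 3 = theta_coeff q (q ^ 8) r * (1 - q ^ (2 * r + 1))"
proof -
  have "dixon_exp r + (r\<^sup>2 + r) * 3 = (r choose 2) + 8 * (Suc r choose 2)"
    by (induction r) (simp_all add: dixon_exp_Suc numeral_2_eq_2)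
  hence "q ^ dixon_exp r * (q ^ (r\<^sup>2 + r)) ^ 3 = q ^ (r choose 2) * (q ^ 8) ^ (Suc r choose 2)"
    by (simp only: power_mult[symmetric] power_add[symmetric])
  thus ?thesis
    by (simp add: dixon_weight_def theta_coeff_def)
qed

theorem mainTheorem14:
  fixes q :: complex
  assumes "norm q < 1"
  shows "((\<lambda>(n, l, k).
            q ^ (n^2 + l^2 + k^2 + n + l + k) * qpoch (q^2) q (n + l + k) /
            (qpoch (q^2) q (n + l) * qpoch (q^2) q (n + k) * qpoch (q^2) q (l + k) *
             qpoch q q n * qpoch q q l * qpoch q q k))
          has_sum
            (1 / (qpoch_inf (q^2) q)^2 *
             (\<Prod>m. if m \<ge> 1 \<and> m mod 9 \<notin> {0, 1, 8} then 1 / (1 - q ^ m) else 1)))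
         (UNIV :: (nat \<times> nat \<times> nat) set)"
proof -
  note q = assms
  define \<phi> where "\<phi> = (\<lambda>r n. q ^ (n\<^sup>2 + n) * bailey_kernel q n r)"
  define P where "P = qpoch_inf q q"
  define V where "V = qpoch_inf (q ^ 9) (q ^ 9) * qpoch_inf q (q ^ 9) * qpoch_inf (q ^ 8) (q ^ 9)"
  \<comment> \<open>This family over (r, n, l, k) is summed in two orders: over (n, l, k) first, it
    leaves a theta series in r; over r first, \<open>qdixon\<close> gives the original summand up to
    powers of 1 - q.\<close>
  define h where "h = (\<lambda>p::nat \<times> nat \<times> nat \<times> nat.
    dixon_weight q (fst p) * (\<phi> (fst p) (fst (snd p)) * (\<phi> (fst p) (fst (snd (snd p))) * \<phi> (fst p) (snd (snd (snd p))))))"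
  have q1: "1 - q \<noteq> 0"
    using one_minus_power_nonzero[OF q, of 0] by simp
  have P: "P \<noteq> 0"
    unfolding P_def by (rule qpoch_inf_nonzero[OF q])
  obtain C where C: "C > 0" "\<And>n r. norm (bailey_kernel q n r) \<le> C"
    using bailey_kernel_bounded[OF q] by blast
  \<comment> \<open>A bound for \<open>\<phi> r n\<close> uniform in r, cast to complex so that it
    can be a factor beside \<open>W\<close> in \<open>abs_summable_on_product\<close>. The resulting
    majorant of \<open>h\<close> justifies the exchange of summation.\<close>
  define M where "M = (\<lambda>n. of_real (norm q ^ n * C) :: complex)"
  have nM: "norm (M n) = norm q ^ n * C" for n
    using C by (simp add: M_def norm_mult norm_power)
  have \<phi>_le: "norm (\<phi> r n) \<le> norm (M n)" for r n
    unfolding \<phi>_def nM norm_mult norm_power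
    using C q by (intro mult_mono power_decreasing) auto
  have M: "(\<lambda>n. norm (M n)) summable_on UNIV"
  proof -
    have "summable (\<lambda>n. norm q ^ n * C)"
      using q by (intro summable_mult2 summable_geometric) simp
    thus ?thesis
      unfolding nM using C by (intro norm_summable_imp_summable_on) (simp add: abs_mult)
  qed
  have \<phi>_abs: "(\<lambda>n. norm (\<phi> r n)) summable_on UNIV" for r
    by (rule Infinite_Sum.abs_summable_on_comparison_test'[OF M]) (use \<phi>_le in auto)
  \<comment> \<open>The constant 2 bounds 1 - q^(2r+1), and q^r comes from
    \<open>dixon_exp_ge\<close>.\<close>
  define W where "W = (\<lambda>r. 2 * q ^ r)"
  have W: "(\<lambda>r. norm (W r)) summable_on UNIV"
  proof -
    have "summable (\<lambda>r. 2 * norm q ^ r)"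
      using q by (intro summable_mult summable_geometric) simp
    thus ?thesis
      unfolding W_def by (intro norm_summable_imp_summable_on) (simp add: norm_mult norm_power)
  qed
  have w_le: "norm (dixon_weight q r) \<le> norm (W r)" for r
  proof -
    have "norm q ^ dixon_exp r \<le> norm q ^ r"
      using q by (intro power_decreasing dixon_exp_ge) auto
    moreover have "norm (1 - q ^ (2 * r + 1)) \<le> 2"
    proof -
      have "norm (q ^ (2 * r + 1)) \<le> 1"
        unfolding norm_power using q by (intro power_le_one) auto
      thus ?thesis using norm_triangle_ineq4[of 1 "q ^ (2 * r + 1)"] by simp
    qed
    ultimately have "norm q ^ dixon_exp r * norm (1 - q ^ (2 * r + 1)) \<le> norm q ^ r * 2"
      by (intro mult_mono) auto
    thus ?thesis by (simp add: dixon_weight_def W_def norm_mult norm_power)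
  qed
  have "(\<lambda>p. norm (h p)) summable_on (UNIV \<times> (UNIV \<times> (UNIV \<times> UNIV)))"
  proof (rule Infinite_Sum.abs_summable_on_comparison_test')
    show "(\<lambda>p. norm (W (fst p) * (\<lambda>p. M (fst p) * (\<lambda>p. M (fst p) * M (snd p)) (snd p)) (snd p)))
       summable_on (UNIV \<times> (UNIV \<times> (UNIV \<times> UNIV)))"
      by (intro abs_summable_on_product W M)
    show "norm (h p) \<le> norm (W (fst p) * (\<lambda>p. M (fst p) * (\<lambda>p. M (fst p) * M (snd p)) (snd p)) (snd p))" for p
      unfolding h_def norm_mult by (intro mult_mono w_le \<phi>_le mult_nonneg_nonneg norm_ge_zero)
  qed
  hence "h summable_on (UNIV \<times> UNIV)"
    using abs_summable_summable by fastforce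
  then obtain S where S: "(h has_sum S) (UNIV \<times> UNIV)"
    by (auto simp: summable_on_def)

  have "((\<lambda>r. dixon_weight q r * (q ^ (r\<^sup>2 + r) / P) ^ 3) has_sum S) UNIV"
  proof (rule has_sum_SigmaD[OF S])
    fix r :: nat
    have \<phi>: "(\<phi> r has_sum (q ^ (r\<^sup>2 + r) / P)) UNIV"
      unfolding \<phi>_def P_def by (rule bailey_kernel_sum[OF q])
    have "((\<lambda>p. \<phi> r (fst p) * (\<lambda>p. \<phi> r (fst p) * \<phi> r (snd p)) (snd p)) has_sum
        (q ^ (r\<^sup>2 + r) / P * (q ^ (r\<^sup>2 + r) / P * (q ^ (r\<^sup>2 + r) / P)))) (UNIV \<times> (UNIV \<times> UNIV))"
      by (intro has_sum_product abs_summable_on_product \<phi> \<phi>_abs)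
    from has_sum_cmult_right[OF this, of "dixon_weight q r"]
    show "((\<lambda>y. h (r, y)) has_sum dixon_weight q r * (q ^ (r\<^sup>2 + r) / P) ^ 3) UNIV"
      unfolding h_def by (simp add: power3_eq_cube mult.assoc)
  qed
  hence "(\<lambda>r. dixon_weight q r * (q ^ (r\<^sup>2 + r) / P) ^ 3) sums S"
    by (rule has_sum_imp_sums)
  moreover have "(\<lambda>r. dixon_weight q r * (q ^ (r\<^sup>2 + r) / P) ^ 3) sums (V * (1 / P ^ 3))"
  proof -
    have "norm (q ^ 8) < 1"
      using q power_strict_mono[of "norm q" 1 8] by (simp add: norm_power)
    moreover have "q * q ^ 8 = q ^ 9"
      by (simp add: eval_nat_numeral)
    ultimately have "(\<lambda>r. dixon_weight q r * (q ^ (r\<^sup>2 + r)) ^ 3) sums V"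
      using theta_sums[OF q, of "q ^ 8"] unfolding dixon_weight_theta_coeff V_def by simp
    from sums_mult2[OF this, of "1 / P ^ 3"] show ?thesis
      by (simp add: power_divide)
  qed
  ultimately have S_eq: "S = V / P ^ 3"
    using sums_unique2 by fastforce

  \<comment> \<open>\<open>D\<close> is the summand of the theorem divided by (1 - q)^2: passing
    from base q^2 to base q gives one factor 1 - q in the numerator and three in the
    denominator.\<close>
  define D where "D = (\<lambda>(n, l, k). q ^ (n\<^sup>2 + l\<^sup>2 + k\<^sup>2 + n + l + k) *
      (qpoch q q (n + l + k + 1) * (qinv q (n + l + 1) * qinv q (n + k + 1) * qinv q (l + k + 1) *
      qinv q n * qinv q l * qinv q k)))"
  have "((\<lambda>(y, r). h (r, y)) has_sum S) (UNIV \<times> UNIV)"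
    using S by (subst (asm) has_sum_swap)
  hence "(D has_sum S) UNIV"
  proof (rule has_sum_SigmaD)
    fix y :: "nat \<times> nat \<times> nat"
    obtain n l k where y: "y = (n, l, k)"
      using prod_cases3 by blast
    \<comment> \<open>For fixed (n, l, k) the sum over r is finite, because the kernel in n vanishes
      for r > n.\<close>
    have "((\<lambda>r. h (r, y)) has_sum (\<Sum>r\<le>n. h (r, y))) UNIV"
      by (rule has_sum_finite_neutralI[of "{..n}"]) (auto simp: y h_def \<phi>_def bailey_kernel_def qinv_diff_def)
    moreover have "(\<Sum>r\<le>n. h (r, y)) = D y"
    proof -
      have "(\<Sum>r\<le>n. h (r, y)) = (\<Sum>r\<le>n. q ^ (n\<^sup>2 + l\<^sup>2 + k\<^sup>2 + n + l + k) *
          (dixon_weight q r * bailey_kernel q n r * bailey_kernel q l r * bailey_kernel q k r))"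
        by (simp add: h_def \<phi>_def y power_add mult_ac)
      also have "\<dots> = D y"
        unfolding sum_distrib_left[symmetric] qdixon[OF q order_refl] D_def y by simp
      finally show ?thesis .
    qed
    ultimately show "((\<lambda>r. case (y, r) of (y, r) \<Rightarrow> h (r, y)) has_sum D y) UNIV"
      by simp
  qed
  hence "((\<lambda>y. (1 - q)\<^sup>2 * D y) has_sum ((1 - q)\<^sup>2 * S)) UNIV"
    by (rule has_sum_cmult_right)
  moreover have "(1 - q)\<^sup>2 * D y = (case y of (n, l, k) \<Rightarrow>
            q ^ (n^2 + l^2 + k^2 + n + l + k) * qpoch (q^2) q (n + l + k) /
            (qpoch (q^2) q (n + l) * qpoch (q^2) q (n + k) * qpoch (q^2) q (l + k) *
             qpoch q q n * qpoch q q l * qpoch q q k))" for y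
  proof -
    obtain n l k where y: "y = (n, l, k)"
      using prod_cases3 by blast
    have X: "d\<^sup>2 * (e * (d * N * (1 / (d * a) * (1 / (d * b)) * (1 / (d * c)) * A * B * G)))
       = e * N / (a * b * c) * (A * B * G)" if "d \<noteq> 0" for d e N a b c A B G :: complex
      using that by (simp add: field_simps power2_eq_square)
    show ?thesis
      unfolding y D_def prod.case qinv_def Suc_eq_plus1[symmetric] qpoch_square[symmetric] X[OF q1]
      by simp
  qed
  \<comment> \<open>The same (1 - q)^2 arises on the right from the squared infinite product of base
    q^2.\<close>
  moreover have "(1 - q)\<^sup>2 * S = 1 / (qpoch_inf (q^2) q)^2 *
             (\<Prod>m. if m \<ge> 1 \<and> m mod 9 \<notin> {0, 1, 8} then 1 / (1 - q ^ m) else 1)"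
  proof -
    have eq: "qpoch_inf (q\<^sup>2) q = P / (1 - q)"
      using qpoch_inf_square[OF q] q1 by (simp add: P_def eq_divide_eq mult.commute)
    show ?thesis
      unfolding restricted_product_mod_9[OF q] S_eq V_def[symmetric] P_def[symmetric] eq
      by (simp add: power_divide power2_eq_square power3_eq_cube)
  qed
  ultimately show ?thesis
    by simp
qed

end
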